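(* Let $(X,d)$ be a complete $\mathrm{CAT}(0)$ space. The Fréchet mean of any finite set of points in $X$ lies in the closure of the convex hull of the given set.
   Context: A $\mathrm{CAT}(0)$ space is a geodesic metric space in which every geodesic triangle is at least as thin as its Euclidean comparison triangle; it is uniquely geodesic, and $[x,y]$ denotes the geodesic segment joining $x$ and $y$. A set $C\subseteq X$ is convex if $[x,y]\subseteq C$ for all $x,y\in C$; the convex hull of a set is the smallest convex set containing it. For points $x_1,\dots,x_n\in X$ and given non-negative numbers (weights) $w_1,\dots,w_n\in[0,1]$, the Fréchet mean of $x_1,\dots,x_n$ with respect to these weights is the unique minimizer over $x\in X$ of $F_2(x)=\sum_{i=1}^nw_i\,d(x,x_i)^2$. *)

theory Defs
  imports "HOL-Analysis.Analysis"
begin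

context metric_space
begin

definition geodesic_path :: "(real \<Rightarrow> 'a) \<Rightarrow> 'a \<Rightarrow> 'a \<Rightarrow> bool" where
  "geodesic_path c x y \<longleftrightarrow> c 0 = x \<and> c (dist x y) = y \<and>
     (\<forall>s\<in>{0..dist x y}. \<forall>t\<in>{0..dist x y}. dist (c s) (c t) = \<bar>s - t\<bar>)"

definition is_geodesic_segment :: "'a set \<Rightarrow> 'a \<Rightarrow> 'a \<Rightarrow> bool" where
  "is_geodesic_segment S x y \<longleftrightarrow> (\<exists>c. geodesic_path c x y \<and> S = c ` {0..dist x y})"

text \<open>
  Comparison triangles live in the Euclidean plane \<^typ>\<open>real^2\<close>; the point on
  \<open>[p', q']\<close> corresponding to \<open>x\<close> on a side from \<open>p\<close> to \<open>q\<close> is the one at the same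
  distance from the first endpoint.
\<close>

definition side_comparison ::
  "'a set \<Rightarrow> 'a \<Rightarrow> 'a \<Rightarrow> real^2 \<Rightarrow> real^2 \<Rightarrow> 'a \<Rightarrow> real^2 \<Rightarrow> bool" where
  "side_comparison S p q p' q' x x' \<longleftrightarrow>
     x \<in> S \<and> x' \<in> closed_segment p' q' \<and> dist p' x' = dist p x"

definition geodesic_triangle ::
  "'a \<Rightarrow> 'a \<Rightarrow> 'a \<Rightarrow> 'a set \<Rightarrow> 'a set \<Rightarrow> 'a set \<Rightarrow> bool" where
  "geodesic_triangle p q r Spq Sqr Spr \<longleftrightarrow>
     is_geodesic_segment Spq p q \<and> is_geodesic_segment Sqr q r \<and> is_geodesic_segment Spr p r"

definition comparison_triangle ::
  "'a \<Rightarrow> 'a \<Rightarrow> 'a \<Rightarrow> real^2 \<Rightarrow> real^2 \<Rightarrow> real^2 \<Rightarrow> bool" where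
  "comparison_triangle p q r p' q' r' \<longleftrightarrow>
     dist p' q' = dist p q \<and> dist q' r' = dist q r \<and> dist p' r' = dist p r"

definition comparison_point ::
  "'a \<Rightarrow> 'a \<Rightarrow> 'a \<Rightarrow> 'a set \<Rightarrow> 'a set \<Rightarrow> 'a set \<Rightarrow> real^2 \<Rightarrow> real^2 \<Rightarrow> real^2 \<Rightarrow> 'a \<Rightarrow> real^2 \<Rightarrow> bool" where
  "comparison_point p q r Spq Sqr Spr p' q' r' x x' \<longleftrightarrow>
     side_comparison Spq p q p' q' x x' \<or> side_comparison Sqr q r q' r' x x' \<or>
     side_comparison Spr p r p' r' x x'"

end

text \<open>
  The inequality quantifies over all comparison triangles; one always exists (see
  \<open>comparison_triangle_exists\<close> below) and it is unique up to isometry.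
\<close>

class cat0_space = metric_space +
  assumes geodesic_segment_exists: "\<exists>S. is_geodesic_segment S x y"
    and cat0_inequality:
      "\<lbrakk>geodesic_triangle p q r Spq Sqr Spr; comparison_triangle p q r p' q' r';
        comparison_point p q r Spq Sqr Spr p' q' r' x x';
        comparison_point p q r Spq Sqr Spr p' q' r' y y'\<rbrakk> \<Longrightarrow> dist x y \<le> dist x' y'"

lemma comparison_triangle_exists:
  fixes p q r :: "'a::metric_space"
  shows "\<exists>p' q' r'. comparison_triangle p q r p' q' r'"
proof -
  define a b c where "a = dist q r" and "b = dist p q" and "c = dist p r"
  have tri: "a \<ge> 0" "b \<ge> 0" "c \<ge> 0" "a \<le> b + c" "b \<le> a + c" "c \<le> a + b"
    unfolding a_def b_def c_def
    using dist_triangle[of q r p] dist_triangle[of p q r] dist_triangle[of p r q]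
    by (auto simp: dist_commute)
  have nrm: "dist (vector [s, t] :: real^2) (vector [s', t']) = sqrt ((s - s')\<^sup>2 + (t - t')\<^sup>2)"
    for s t s' t' :: real
    by (simp add: dist_vec_def L2_set_def sum_2 dist_real_def)
  obtain u v where uv: "u\<^sup>2 + v\<^sup>2 = b\<^sup>2" "(u - a)\<^sup>2 + v\<^sup>2 = c\<^sup>2"
  proof (cases "a = 0")
    case True
    then have "b = c" using tri by auto
    then show ?thesis using True that[of b 0] by simp
  next
    case False
    then have a: "a > 0" using tri by simp
    define u where "u = (b\<^sup>2 + a\<^sup>2 - c\<^sup>2) / (2 * a)"
    have u2: "2 * a * u = b\<^sup>2 + a\<^sup>2 - c\<^sup>2" using a by (simp add: u_def)
    have "(a - b)\<^sup>2 \<le> c\<^sup>2" using tri by (intro abs_le_square_iff[THEN iffD1]) auto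
    then have "2 * a * u \<le> 2 * a * b" using u2 by (simp add: power2_diff)
    then have ub: "u \<le> b" using a by simp
    have "c\<^sup>2 \<le> (a + b)\<^sup>2" using tri by (intro power_mono) auto
    then have "2 * a * (- b) \<le> 2 * a * u" using u2 by (simp add: power2_sum)
    then have lb: "- b \<le> u" using a by (subst (asm) mult_le_cancel_left_pos) auto
    have "u\<^sup>2 \<le> b\<^sup>2" using ub lb tri by (intro abs_le_square_iff[THEN iffD1]) auto
    then have v: "(sqrt (b\<^sup>2 - u\<^sup>2))\<^sup>2 = b\<^sup>2 - u\<^sup>2" by simp
    show ?thesis
      using u2 v by (intro that[of u "sqrt (b\<^sup>2 - u\<^sup>2)"]) (simp_all add: power2_diff algebra_simps)
  qed
  have "comparison_triangle p q r (vector [u, v]) (vector [0, 0]) (vector [a, 0])"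
    using uv tri by (simp add: comparison_triangle_def nrm a_def[symmetric] b_def[symmetric] c_def[symmetric])
  then show ?thesis by blast
qed

lemma geodesic_path_dist:
  assumes "geodesic_path c x y" "t \<in> {0..dist x y}"
  shows "dist x (c t) = t"
proof -
  have "dist (c 0) (c t) = \<bar>0 - t\<bar>"
    using assms(2) by (intro assms(1)[unfolded geodesic_path_def, THEN conjunct2, THEN conjunct2, rule_format]) auto
  then show ?thesis using assms by (simp add: geodesic_path_def)
qed

lemma geodesic_segment_unique:
  fixes x y :: "'a::cat0_space"
  assumes "is_geodesic_segment S x y" "is_geodesic_segment T x y"
  shows "S = T"
proof -
  obtain c e where c: "geodesic_path c x y" "S = c ` {0..dist x y}"
    and e: "geodesic_path e x y" "T = e ` {0..dist x y}"
    using assms by (auto simp: is_geodesic_segment_def)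
  have y: "is_geodesic_segment {y} y y"
    unfolding is_geodesic_segment_def geodesic_path_def by (intro exI[of _ "\<lambda>_. y"]) auto
  have tri: "geodesic_triangle x y y S {y} T"
    using assms y by (simp add: geodesic_triangle_def)
  obtain p' q' r' where cmp: "comparison_triangle x y y p' q' r'"
    using comparison_triangle_exists by blast
  then have r': "r' = q'" and L: "dist p' q' = dist x y" by (auto simp: comparison_triangle_def)
  have "c t = e t" if t: "t \<in> {0..dist x y}" for t
  proof -
    have d: "dist x (c t) = t" "dist x (e t) = t"
      using geodesic_path_dist[OF c(1) t] geodesic_path_dist[OF e(1) t] by auto
    define u where "u = (if dist x y = 0 then 0 else t / dist x y)"
    have u: "0 \<le> u" "u \<le> 1" "u * dist x y = t" using t by (auto simp: u_def)
    define z where "z = (1 - u) *\<^sub>R p' + u *\<^sub>R q'"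
    have z: "z \<in> closed_segment p' q'" using u by (auto simp: z_def in_segment)
    have "p' - z = u *\<^sub>R (p' - q')" by (simp add: z_def algebra_simps)
    then have "dist p' z = t" using u L by (simp add: dist_norm)
    then have "comparison_point x y y S {y} T p' q' r' (c t) z"
      "comparison_point x y y S {y} T p' q' r' (e t) z"
      using z d t c(2) e(2) r' by (auto simp: comparison_point_def side_comparison_def)
    from cat0_inequality[OF tri cmp this] show "c t = e t" by simp
  qed
  then show ?thesis using c(2) e(2) by auto
qed

text \<open>The description below is proper by \<open>geodesic_segment_unique\<close>.\<close>

definition geodesic_segment :: "'a::cat0_space \<Rightarrow> 'a \<Rightarrow> 'a set" where
  "geodesic_segment x y = (THE S. is_geodesic_segment S x y)"

lemma is_geodesic_segment_geodesic_segment: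
  "is_geodesic_segment (geodesic_segment x y) x y"
  unfolding geodesic_segment_def
  using geodesic_segment_exists geodesic_segment_unique by (metis theI)

definition geodesically_convex :: "'a::cat0_space set \<Rightarrow> bool" where
  "geodesically_convex C \<longleftrightarrow> (\<forall>x\<in>C. \<forall>y\<in>C. geodesic_segment x y \<subseteq> C)"

lemma geodesically_convex_hull:
  fixes S :: "'a::cat0_space set"
  shows "geodesically_convex (geodesically_convex hull S)"
proof (rule hull_in)
  fix T :: "'a set set"
  assume "\<forall>C\<in>T. geodesically_convex C"
  then show "geodesically_convex (\<Inter>T)"
    unfolding geodesically_convex_def by (meson InterE InterI subset_iff)
qed

definition frechet_fun :: "nat \<Rightarrow> (nat \<Rightarrow> real) \<Rightarrow> (nat \<Rightarrow> 'a::metric_space) \<Rightarrow> 'a \<Rightarrow> real" where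
  "frechet_fun n w x z = (\<Sum>i=1..n. w i * (dist z (x i))\<^sup>2)"

text \<open>
  The weights are not normalised. If all of them vanish, every point is a minimiser, so there
  is no Frechet mean unless the space is a single point; otherwise a Frechet mean exists for
  nonnegative weights, see \<open>frechet_mean_exists\<close>.
\<close>

definition is_frechet_mean :: "nat \<Rightarrow> (nat \<Rightarrow> real) \<Rightarrow> (nat \<Rightarrow> 'a::metric_space) \<Rightarrow> 'a \<Rightarrow> bool" where
  "is_frechet_mean n w x m \<longleftrightarrow>
     is_arg_min (frechet_fun n w x) (\<lambda>_. True) m \<and>
     (\<forall>y. is_arg_min (frechet_fun n w x) (\<lambda>_. True) y \<longrightarrow> y = m)"

lemma cat0_midpoint:
  fixes q r :: "'a::cat0_space"
  shows "\<exists>m. \<forall>p. (dist p m)\<^sup>2 \<le> (dist p q)\<^sup>2 / 2 + (dist p r)\<^sup>2 / 2 - (dist q r)\<^sup>2 / 4"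
proof -
  obtain S c where c: "geodesic_path c q r" "S = c ` {0..dist q r}" "is_geodesic_segment S q r"
    using geodesic_segment_exists[of q r] by (auto simp: is_geodesic_segment_def)
  define m where "m = c (dist q r / 2)"
  have m: "m \<in> S" "dist q m = dist q r / 2"
    using c(2) geodesic_path_dist[OF c(1), of "dist q r / 2"] by (auto simp: m_def)
  have "(dist p m)\<^sup>2 \<le> (dist p q)\<^sup>2 / 2 + (dist p r)\<^sup>2 / 2 - (dist q r)\<^sup>2 / 4" for p
  proof -
    obtain A B where AB: "is_geodesic_segment A p q" "is_geodesic_segment B p r"
      using geodesic_segment_exists by meson
    have tri: "geodesic_triangle p q r A S B" using AB c by (simp add: geodesic_triangle_def)
    obtain p' q' r' where cmp: "comparison_triangle p q r p' q' r'"
      using comparison_triangle_exists by blast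
    have "p \<in> A" using AB(1) unfolding is_geodesic_segment_def geodesic_path_def by force
    then have 1: "comparison_point p q r A S B p' q' r' p p'"
      by (simp add: comparison_point_def side_comparison_def)
    have 2: "comparison_point p q r A S B p' q' r' m (midpoint q' r')"
      using m cmp by (simp add: comparison_point_def side_comparison_def comparison_triangle_def dist_midpoint)
    have "dist p m \<le> dist p' (midpoint q' r')" by (rule cat0_inequality[OF tri cmp 1 2])
    then have "(dist p m)\<^sup>2 \<le> (dist p' (midpoint q' r'))\<^sup>2" by (simp add: power_mono)
    also have "\<dots> = (dist p' q')\<^sup>2 / 2 + (dist p' r')\<^sup>2 / 2 - (dist q' r')\<^sup>2 / 4"
      unfolding dist_norm power2_norm_eq_inner midpoint_def
      by (simp add: inner_add inner_diff inner_commute field_simps)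
    finally show ?thesis using cmp by (simp add: comparison_triangle_def)
  qed
  then show ?thesis by blast
qed

lemma frechet_mean_exists:
  fixes x :: "nat \<Rightarrow> 'a::{cat0_space, complete_space}"
  assumes w: "\<And>i. i \<in> {1..n} \<Longrightarrow> w i \<ge> 0" and j: "j \<in> {1..n}" "w j > 0"
  shows "\<exists>m. is_frechet_mean n w x m"
proof -
  define F where "F = frechet_fun n w x"
  define W where "W = (\<Sum>i=1..n. w i)"
  have W: "W > 0" unfolding W_def using j w by (intro sum_pos2) auto
  have F0: "F z \<ge> 0" for z
    unfolding F_def frechet_fun_def using w by (intro sum_nonneg) auto
  have bdd: "bdd_below (range F)" using F0 by (auto intro!: bdd_belowI)
  define I where "I = Inf (range F)"
  have I: "I \<le> F z" for z unfolding I_def using bdd by (simp add: cInf_lower)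
  have key: "W * (dist a b)\<^sup>2 / 4 \<le> F a / 2 + F b / 2 - I" for a b
  proof -
    obtain m where m: "\<And>p. (dist p m)\<^sup>2 \<le> (dist p a)\<^sup>2 / 2 + (dist p b)\<^sup>2 / 2 - (dist a b)\<^sup>2 / 4"
      using cat0_midpoint by meson
    have "F m \<le> (\<Sum>i=1..n. w i * ((dist a (x i))\<^sup>2 / 2 + (dist b (x i))\<^sup>2 / 2 - (dist a b)\<^sup>2 / 4))"
      unfolding F_def frechet_fun_def
      using m w by (intro sum_mono mult_left_mono) (simp_all add: dist_commute[of _ "x _"])
    also have "\<dots> = F a / 2 + F b / 2 - W * (dist a b)\<^sup>2 / 4"
      by (simp add: F_def frechet_fun_def W_def sum_distrib_right sum_divide_distrib
          sum.distrib sum_subtractf distrib_left right_diff_distrib)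
    finally show ?thesis using I[of m] by simp
  qed
  have "\<exists>z. F z < I + 1 / real (Suc k)" for k
    using cInf_less_iff[of "range F" "I + 1 / real (Suc k)"] bdd by (auto simp: I_def)
  then obtain z where z: "\<And>k. F (z k) < I + 1 / real (Suc k)" by metis
  have "Cauchy z"
  proof (rule metric_CauchyI)
    fix e :: real assume e: "e > 0"
    then have "W * e\<^sup>2 / 4 > 0" using W by simp
    then obtain N where N: "1 / real (Suc N) < W * e\<^sup>2 / 4" using nat_approx_posE by blast
    show "\<exists>M. \<forall>k\<ge>M. \<forall>l\<ge>M. dist (z k) (z l) < e"
    proof (intro exI allI impI)
      fix k l assume "k \<ge> N" "l \<ge> N"
      then have "1 / real (Suc k) \<le> 1 / real (Suc N)" "1 / real (Suc l) \<le> 1 / real (Suc N)"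
        by (auto intro!: divide_left_mono)
      then have "W * (dist (z k) (z l))\<^sup>2 / 4 < W * e\<^sup>2 / 4"
        using key[of "z k" "z l"] z[of k] z[of l] N by argo
      then have "(dist (z k) (z l))\<^sup>2 < e\<^sup>2" using W by simp
      then show "dist (z k) (z l) < e" using e by (simp add: power_less_imp_less_base)
    qed
  qed
  then obtain m where m: "z \<longlonglongrightarrow> m" by (auto simp: Cauchy_convergent_iff convergent_def)
  have "(\<lambda>k. F (z k)) \<longlonglongrightarrow> F m"
    unfolding F_def frechet_fun_def by (intro tendsto_intros m)
  moreover have "(\<lambda>k. I + 1 / real (Suc k)) \<longlonglongrightarrow> I + 0"
    by (intro tendsto_add tendsto_const LIMSEQ_Suc lim_1_over_n)
  ultimately have "F m \<le> I + 0"
    using z by (intro LIMSEQ_le) (auto intro: less_imp_le)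
  then have Fm: "F m = I" using I[of m] by simp
  have "y = m" if y: "F y \<le> F m" for y
  proof -
    have "W * (dist y m)\<^sup>2 / 4 \<le> 0" using key[of y m] y Fm by simp
    then have "(dist y m)\<^sup>2 \<le> 0" using W by (simp add: mult_le_0_iff)
    then show ?thesis by simp
  qed
  then have "is_frechet_mean n w x m"
    unfolding is_frechet_mean_def F_def[symmetric] is_arg_min_linorder using I Fm by auto
  then show ?thesis by blast
qed

end

theory Submission imports Defs begin

text \<open>
  The nearest-point projection \<open>p\<close> of \<open>m\<close> to the closed convex hull is no farther than \<open>m\<close>
  from any point of the hull, so it does not increase the Frechet functional, and uniqueness of
  the minimiser forces \<open>p = m\<close>.
\<close>

text \<open>Comparison in a single triangle reduces the bound to Stewart's identity in the Euclidean
  plane, with \<open>z'\<close> dividing the side from \<open>q'\<close> to \<open>r'\<close> in the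
  ratio \<open>t\<close> to \<open>1 - t\<close>.\<close>

lemma cat0_segment_point:
  fixes q r :: "'a::cat0_space"
  assumes t: "0 \<le> t" "t \<le> 1"
  obtains z where "z \<in> geodesic_segment q r"
    and "\<And>p. (dist p z)\<^sup>2 \<le> (1 - t) * (dist p q)\<^sup>2 + t * (dist p r)\<^sup>2 - t * (1 - t) * (dist q r)\<^sup>2"
proof -
  define S where "S = geodesic_segment q r"
  have S: "is_geodesic_segment S q r"
    unfolding S_def by (rule is_geodesic_segment_geodesic_segment)
  then obtain c where c: "geodesic_path c q r" "S = c ` {0..dist q r}"
    by (auto simp: is_geodesic_segment_def)
  define z where "z = c (t * dist q r)"
  have "t * dist q r \<in> {0..dist q r}" using t by (simp add: mult_left_le_one_le)
  then have z: "z \<in> S" "dist q z = t * dist q r"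
    using c(2) geodesic_path_dist[OF c(1)] by (auto simp: z_def)
  have "(dist p z)\<^sup>2 \<le> (1 - t) * (dist p q)\<^sup>2 + t * (dist p r)\<^sup>2 - t * (1 - t) * (dist q r)\<^sup>2" for p
  proof -
    obtain A B where AB: "is_geodesic_segment A p q" "is_geodesic_segment B p r"
      using geodesic_segment_exists by meson
    have tri: "geodesic_triangle p q r A S B" using AB S by (simp add: geodesic_triangle_def)
    obtain p' q' r' where cmp: "comparison_triangle p q r p' q' r'"
      using comparison_triangle_exists by blast
    define z' where "z' = (1 - t) *\<^sub>R q' + t *\<^sub>R r'"
    have "q' - z' = t *\<^sub>R (q' - r')" by (simp add: z'_def algebra_simps)
    then have "dist q' z' = t * dist q' r'" using t by (simp add: dist_norm)
    moreover have "z' \<in> closed_segment q' r'" using t by (auto simp: z'_def in_segment)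
    ultimately have cz: "comparison_point p q r A S B p' q' r' z z'"
      using z cmp by (simp add: comparison_point_def side_comparison_def comparison_triangle_def)
    have "p \<in> A" using AB(1) unfolding is_geodesic_segment_def geodesic_path_def by force
    then have cp: "comparison_point p q r A S B p' q' r' p p'"
      by (simp add: comparison_point_def side_comparison_def)
    have "dist p z \<le> dist p' z'" by (rule cat0_inequality[OF tri cmp cp cz])
    then have "(dist p z)\<^sup>2 \<le> (dist p' z')\<^sup>2" by (simp add: power_mono)
    also have "\<dots> = (1 - t) * (dist p' q')\<^sup>2 + t * (dist p' r')\<^sup>2 - t * (1 - t) * (dist q' r')\<^sup>2"
      unfolding dist_norm power2_norm_eq_inner z'_def
      by (simp add: inner_add inner_diff inner_commute algebra_simps)
    finally show ?thesis using cmp by (simp add: comparison_triangle_def)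
  qed
  then show ?thesis using z that by (simp add: S_def)
qed

text \<open>Convexity keeps the dividing point of the segment inside \<open>C\<close>, so its
  distance to \<open>m\<close> is at least \<open>infdist m C\<close>. The value
  \<open>t = 1/2\<close> makes minimising sequences Cauchy; general \<open>t\<close> yields the
  variational inequality at their limit.\<close>

lemma infdist_geodesically_convex:
  fixes C :: "'a::cat0_space set"
  assumes C: "geodesically_convex C" and ab: "a \<in> C" "b \<in> C" and t: "0 \<le> t" "t \<le> 1"
  shows "(infdist m C)\<^sup>2 \<le> (1 - t) * (dist m a)\<^sup>2 + t * (dist m b)\<^sup>2 - t * (1 - t) * (dist a b)\<^sup>2"
proof -
  obtain z where z: "z \<in> geodesic_segment a b"
    "(dist m z)\<^sup>2 \<le> (1 - t) * (dist m a)\<^sup>2 + t * (dist m b)\<^sup>2 - t * (1 - t) * (dist a b)\<^sup>2"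
    using cat0_segment_point[OF t] by metis
  have "z \<in> C" using z(1) C ab by (auto simp: geodesically_convex_def)
  then have "(infdist m C)\<^sup>2 \<le> (dist m z)\<^sup>2"
    by (intro power_mono infdist_le infdist_nonneg)
  then show ?thesis using z(2) by simp
qed

text \<open>The projection is the limit of a minimising sequence in \<open>C\<close>;
  \<open>C\<close> need not be closed, hence \<open>p\<close> lies only in the closure. The
  inequality is the Pythagorean form of a non-acute angle at \<open>p\<close> between
  \<open>m\<close> and \<open>y\<close>.\<close>

lemma cat0_projection:
  fixes C :: "'a::{cat0_space, complete_space} set"
  assumes C: "geodesically_convex C" "C \<noteq> {}"
  obtains p where "p \<in> closure C"
    and "\<And>y. y \<in> C \<Longrightarrow> (dist p y)\<^sup>2 + (infdist m C)\<^sup>2 \<le> (dist m y)\<^sup>2"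
proof -
  define \<delta> where "\<delta> = infdist m C"
  have \<delta>: "0 \<le> \<delta>" "\<And>y. y \<in> C \<Longrightarrow> \<delta> \<le> dist m y"
    by (auto simp: \<delta>_def infdist_nonneg infdist_le)
  have "\<exists>z\<in>C. (dist m z)\<^sup>2 < \<delta>\<^sup>2 + 1 / real (Suc k)" for k
  proof -
    \<comment> \<open>The slack is placed on the squared distance, because all later estimates are
      in squares.\<close>
    have "\<delta> < sqrt (\<delta>\<^sup>2 + 1 / real (Suc k))" using \<delta>(1) by (intro real_less_rsqrt) simp
    then obtain z where "z \<in> C" "dist m z < sqrt (\<delta>\<^sup>2 + 1 / real (Suc k))"
      using C(2) cINF_less_iff[of C "dist m"] by (auto simp: \<delta>_def infdist_def)
    then have "(dist m z)\<^sup>2 < (sqrt (\<delta>\<^sup>2 + 1 / real (Suc k)))\<^sup>2"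
      by (intro power_strict_mono) simp_all
    then show ?thesis using \<open>z \<in> C\<close> by (intro bexI[of _ z]) simp_all
  qed
  then obtain z where z: "\<And>k. z k \<in> C" "\<And>k. (dist m (z k))\<^sup>2 < \<delta>\<^sup>2 + 1 / real (Suc k)" by metis
  have "Cauchy z"
  proof (rule metric_CauchyI)
    fix e :: real assume e: "e > 0"
    then have "e\<^sup>2 / 4 > 0" by simp
    then obtain N where N: "1 / real (Suc N) < e\<^sup>2 / 4" using nat_approx_posE by blast
    show "\<exists>M. \<forall>k\<ge>M. \<forall>l\<ge>M. dist (z k) (z l) < e"
    proof (intro exI allI impI)
      fix k l assume "k \<ge> N" "l \<ge> N"
      then have "1 / real (Suc k) \<le> 1 / real (Suc N)" "1 / real (Suc l) \<le> 1 / real (Suc N)"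
        by (auto intro!: divide_left_mono)
      \<comment> \<open>The midpoint of \<open>z k\<close> and \<open>z l\<close> is no closer to
        \<open>m\<close> than \<delta>, so a quarter of their squared distance is at most the
        average of the two slacks, hence below \<open>e\<^sup>2 / 4\<close>.\<close>
      moreover have "\<delta>\<^sup>2 \<le> (dist m (z k))\<^sup>2 / 2 + (dist m (z l))\<^sup>2 / 2 - (dist (z k) (z l))\<^sup>2 / 4"
        using infdist_geodesically_convex[OF C(1) z(1) z(1), of "1/2" m k l] by (simp add: \<delta>_def)
      ultimately have "(dist (z k) (z l))\<^sup>2 < e\<^sup>2"
        using z(2)[of k] z(2)[of l] N by argo
      then show "dist (z k) (z l) < e" using e by (simp add: power_less_imp_less_base)
    qed
  qed
  then obtain p where p: "z \<longlonglongrightarrow> p" by (auto simp: Cauchy_convergent_iff convergent_def)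
  have "(\<lambda>k. \<delta>\<^sup>2 + 1 / real (Suc k)) \<longlonglongrightarrow> \<delta>\<^sup>2 + 0"
    by (intro tendsto_add tendsto_const LIMSEQ_Suc lim_1_over_n)
  moreover have "\<delta>\<^sup>2 \<le> (dist m (z k))\<^sup>2" "(dist m (z k))\<^sup>2 \<le> \<delta>\<^sup>2 + 1 / real (Suc k)" for k
    using \<delta>(2)[OF z(1)] \<delta>(1) z(2)[of k] by (simp_all add: power_mono less_imp_le)
  ultimately have "(\<lambda>k. (dist m (z k))\<^sup>2) \<longlonglongrightarrow> \<delta>\<^sup>2"
    using tendsto_sandwich[of "\<lambda>_. \<delta>\<^sup>2" "\<lambda>k. (dist m (z k))\<^sup>2" sequentially
        "\<lambda>k. \<delta>\<^sup>2 + 1 / real (Suc k)" "\<delta>\<^sup>2"] by simp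
  note lim = this p
  have "(dist p y)\<^sup>2 \<le> (dist m y)\<^sup>2 - \<delta>\<^sup>2" if y: "y \<in> C" for y
  \<comment> \<open>The points \<open>z k\<close> stand in for \<open>p\<close>, which may lie
    outside \<open>C\<close>: the bound at parameter \<open>1 - s\<close> from \<open>z k\<close>
    towards \<open>y\<close> passes to the limit in \<open>k\<close>. Cancelling
    \<open>1 - s\<close> leaves a factor \<open>s\<close>, which this rule removes as
    \<open>s\<close> tends to 1.\<close>
  proof (rule field_le_mult_one_interval)
    fix s :: real assume s: "0 < s" "s < 1"
    have "(\<lambda>k. s * (dist m (z k))\<^sup>2 + (1 - s) * (dist m y)\<^sup>2 - (1 - s) * s * (dist (z k) y)\<^sup>2)
        \<longlonglongrightarrow> s * \<delta>\<^sup>2 + (1 - s) * (dist m y)\<^sup>2 - (1 - s) * s * (dist p y)\<^sup>2"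
      by (intro tendsto_intros lim)
    moreover have "\<delta>\<^sup>2 \<le> s * (dist m (z k))\<^sup>2 + (1 - s) * (dist m y)\<^sup>2 - (1 - s) * s * (dist (z k) y)\<^sup>2" for k
      using infdist_geodesically_convex[OF C(1) z(1) y, of "1 - s" m k] s by (simp add: \<delta>_def)
    ultimately have "\<delta>\<^sup>2 \<le> s * \<delta>\<^sup>2 + (1 - s) * (dist m y)\<^sup>2 - (1 - s) * s * (dist p y)\<^sup>2"
      by (intro LIMSEQ_le_const) auto
    then have "(1 - s) * (s * (dist p y)\<^sup>2) \<le> (1 - s) * ((dist m y)\<^sup>2 - \<delta>\<^sup>2)"
      by (simp add: algebra_simps)
    then show "s * (dist p y)\<^sup>2 \<le> (dist m y)\<^sup>2 - \<delta>\<^sup>2" using s by simp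
  qed
  moreover have "p \<in> closure C" using z(1) p closure_sequential by blast
  ultimately show ?thesis using that by (simp add: \<delta>_def le_diff_eq)
qed

theorem lemma4:
  fixes x :: "nat \<Rightarrow> 'a::{cat0_space, complete_space}"
    and w :: "nat \<Rightarrow> real"
    and n :: nat
    and m :: 'a
  assumes "n \<ge> 1"
    and "\<And>i. i \<in> {1..n} \<Longrightarrow> w i \<in> {0..1}"
    and "is_frechet_mean n w x m"
  shows "m \<in> closure (geodesically_convex hull (x ` {1..n}))"
proof -
  define C where "C = geodesically_convex hull (x ` {1..n})"
  have xC: "x i \<in> C" if "i \<in> {1..n}" for i
    unfolding C_def using that by (intro hull_inc imageI)
  then have "C \<noteq> {}" using assms(1) by force
  moreover have "geodesically_convex C" unfolding C_def by (rule geodesically_convex_hull)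
  ultimately obtain p where p: "p \<in> closure C"
    "\<And>y. y \<in> C \<Longrightarrow> (dist p y)\<^sup>2 + (infdist m C)\<^sup>2 \<le> (dist m y)\<^sup>2"
    using cat0_projection[of C m] by blast
  have le: "(dist p y)\<^sup>2 \<le> (dist m y)\<^sup>2" if "y \<in> C" for y
    using p(2)[OF that] zero_le_power2[of "infdist m C"] by linarith
  have "frechet_fun n w x p \<le> frechet_fun n w x m"
    unfolding frechet_fun_def using assms(2) le xC by (intro sum_mono mult_left_mono) auto
  \<comment> \<open>The weak inequality suffices: uniqueness is part of
    \<open>is_frechet_mean\<close>, so no weight has to be shown positive to force a strict
    decrease.\<close>
  then have "is_arg_min (frechet_fun n w x) (\<lambda>_. True) p"
    using assms(3) unfolding is_frechet_mean_def is_arg_min_linorder by (meson order_trans)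
  then have "p = m" using assms(3) by (simp add: is_frechet_mean_def)
  then show ?thesis using p(1) by (simp add: C_def)
qed

end
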